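(* For $n\ge 0$ let $T_n(b,c)$ be the coefficient of $x^n$ in the expansion of $(x^2+bx+c)^n$, regarded as a polynomial in $b$ and $c$. Let $j\ge i\ge 1$ be integers. Then $$T_{i-1}(b,c)T_{j+1}(b,c)-T_{i}(b,c)T_{j}(b,c)=b^{\frac{1-(-1)^{i+j}}{2}}\,f_{ij}(b^2-2c,\,c),$$ where $f_{ij}(x,y)$ is a polynomial in $x$ and $y$ with nonnegative integer coefficients.
   Context: Explicitly, $T_n(b,c)=\sum_{k=0}^{\lfloor n/2\rfloor}\frac{n!}{k!\,k!\,(n-2k)!}b^{n-2k}c^k$. *)

theory Defs
  imports "HOL-Computational_Algebra.Polynomial"
begin

definition gen_trinomial :: "nat \<Rightarrow> 'a::comm_ring_1 \<Rightarrow> 'a \<Rightarrow> 'a" where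
  "gen_trinomial n b c = coeff ([:c, b, 1:] ^ n) n"

text \<open>
  The type \<open>int poly poly\<close> plays the role of the polynomial ring in two variables over the
  integers: the inner polynomials are in the first variable, the outer ones in the second.
  Thus \<open>coeff (coeff p l) k\<close> is the coefficient of (first variable)\<open>^k\<close> (second variable)\<open>^l\<close>.
\<close>

definition indet1 :: "int poly poly" where
  "indet1 = [:[:0, 1:]:]"

definition indet2 :: "int poly poly" where
  "indet2 = [:0, 1:]"

definition eval_bivariate :: "int poly poly \<Rightarrow> 'a::comm_ring_1 \<Rightarrow> 'a \<Rightarrow> 'a" where
  "eval_bivariate p x y = poly (map_poly (\<lambda>q. poly (map_poly of_int q) x) p) y"

end

theory Submission
  imports Defs
begin

text \<open>
  Let \<open>a n k\<close> be the coefficient of \<open>x^(n+k)\<close> in \<open>(x^2 + b x + c)^n\<close>. Its rows satisfy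
  \<open>a (n+1) = a n J\<close> for the tridiagonal matrix \<open>J\<close> with diagonal \<open>b, b, b, \<dots>\<close>, superdiagonal
  \<open>1, 1, 1, \<dots>\<close> and subdiagonal \<open>2 c, c, c, \<dots>\<close>. The difference in question is \<open>2 c\<close> times the minor of
  \<open>a\<close> in rows \<open>i - 1, j\<close> and columns \<open>0, 1\<close>. By Cauchy-Binet such a minor is a nonnegative
  combination of products of 2-by-2 minors of \<open>J\<close>, and the only ones with a negative sign are
  \<open>b^2 - 2 c\<close> and \<open>b^2 - c = (b^2 - 2 c) + c\<close>. Even powers of \<open>b\<close> are absorbed through
  \<open>b^2 = (b^2 - 2 c) + 2 c\<close>, so only the parity of the degree in \<open>b\<close> survives.
\<close>

subsection \<open>Evaluation of bivariate polynomials\<close>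

lemma eval_bivariate_0 [simp]: "eval_bivariate 0 x y = 0"
  by (simp add: eval_bivariate_def)

lemma eval_bivariate_1 [simp]: "eval_bivariate 1 x y = 1"
  by (simp add: eval_bivariate_def one_pCons map_poly_pCons)

lemma eval_bivariate_add:
  "eval_bivariate (p + q) x y = eval_bivariate p x y + eval_bivariate q x y"
proof -
  have inner: "map_poly of_int (r + s) = (map_poly of_int r + map_poly of_int s :: 'a poly)"
    for r s
    by (rule poly_eqI) (simp add: coeff_map_poly)
  have "map_poly (\<lambda>r. poly (map_poly of_int r) x) (p + q) =
    map_poly (\<lambda>r. poly (map_poly of_int r) x) p + map_poly (\<lambda>r. poly (map_poly of_int r) x) q"
    by (rule poly_eqI) (simp add: coeff_map_poly inner)
  then show ?thesis by (simp add: eval_bivariate_def)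
qed

text \<open>The inner \<open>[:0, 1:]\<close> is the first variable, so scaling by it shifts every
  coefficient polynomial; \<open>pCons 0\<close> does the same for the second variable. Both keep
  coefficients nonnegative.\<close>

lemma eval_bivariate_smult_indet:
  "eval_bivariate (smult [:0, 1:] p) x y = x * eval_bivariate p x y"
proof -
  have "map_poly (\<lambda>r. poly (map_poly of_int r) x) (smult [:0, 1:] p) =
    smult x (map_poly (\<lambda>r. poly (map_poly of_int r) x) p)"
    by (rule poly_eqI) (simp add: coeff_map_poly map_poly_pCons)
  then show ?thesis by (simp add: eval_bivariate_def)
qed

lemma eval_bivariate_pCons_0:
  "eval_bivariate (pCons 0 p) x y = y * eval_bivariate p x y"
  by (simp add: eval_bivariate_def map_poly_pCons)

subsection \<open>The cone of positive expressions\<close>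

definition nonneg_coeffs :: "int poly poly \<Rightarrow> bool" where
  "nonneg_coeffs f \<longleftrightarrow> (\<forall>k l. 0 \<le> coeff (coeff f l) k)"

text \<open>An unreduced index lets degree counts such as \<open>n + k\<close> serve directly,
  although only their parity matters.\<close>

definition pos_cone :: "'a::comm_ring_1 \<Rightarrow> 'a \<Rightarrow> nat \<Rightarrow> 'a set" where
  "pos_cone b c d =
    {b ^ (d mod 2) * eval_bivariate f (b\<^sup>2 - 2 * c) c | f. nonneg_coeffs f}"

lemma pos_cone_cong: "u \<in> pos_cone b c d \<Longrightarrow> d mod 2 = e mod 2 \<Longrightarrow> u \<in> pos_cone b c e"
  by (simp add: pos_cone_def)

lemma pos_cone_0 [simp]: "0 \<in> pos_cone b c d"
  unfolding pos_cone_def nonneg_coeffs_def by (auto intro!: exI[of _ 0])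

lemma pos_cone_1: "1 \<in> pos_cone b c 0"
  unfolding pos_cone_def nonneg_coeffs_def by (auto intro!: exI[of _ 1] simp: coeff_1)

lemma pos_cone_add:
  assumes "u \<in> pos_cone b c d" and "v \<in> pos_cone b c d"
  shows "u + v \<in> pos_cone b c d"
proof -
  obtain f g where "nonneg_coeffs f" "u = b ^ (d mod 2) * eval_bivariate f (b\<^sup>2 - 2 * c) c"
    "nonneg_coeffs g" "v = b ^ (d mod 2) * eval_bivariate g (b\<^sup>2 - 2 * c) c"
    using assms unfolding pos_cone_def by blast
  then show ?thesis
    unfolding pos_cone_def nonneg_coeffs_def
    by (auto intro!: exI[of _ "f + g"] simp: eval_bivariate_add distrib_left)
qed

lemma pos_cone_mult_indet2:
  assumes "u \<in> pos_cone b c d"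
  shows "c * u \<in> pos_cone b c d"
proof -
  obtain f where "nonneg_coeffs f" "u = b ^ (d mod 2) * eval_bivariate f (b\<^sup>2 - 2 * c) c"
    using assms unfolding pos_cone_def by blast
  then show ?thesis
    unfolding pos_cone_def nonneg_coeffs_def
    by (auto intro!: exI[of _ "pCons 0 f"]
        simp: eval_bivariate_pCons_0 coeff_pCons mult.left_commute split: nat.split)
qed

lemma pos_cone_mult_indet1:
  assumes "u \<in> pos_cone b c d"
  shows "(b\<^sup>2 - 2 * c) * u \<in> pos_cone b c d"
proof -
  obtain f where "nonneg_coeffs f" "u = b ^ (d mod 2) * eval_bivariate f (b\<^sup>2 - 2 * c) c"
    using assms unfolding pos_cone_def by blast
  then show ?thesis
    unfolding pos_cone_def nonneg_coeffs_def
    by (auto intro!: exI[of _ "smult [:0, 1:] f"]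
        simp: eval_bivariate_smult_indet coeff_pCons mult.left_commute split: nat.split)
qed

lemma pos_cone_mult_square:
  assumes "u \<in> pos_cone b c d"
  shows "b\<^sup>2 * u \<in> pos_cone b c d"
proof -
  \<comment> \<open>The factor 2 is written as a repeated summand, here and below, so that the
    closure rules apply.\<close>
  have "(b\<^sup>2 - 2 * c) * u + (c * u + c * u) \<in> pos_cone b c d"
    by (intro pos_cone_add pos_cone_mult_indet1 pos_cone_mult_indet2 assms)
  then show ?thesis by (simp add: algebra_simps)
qed

lemma pos_cone_mult_base:
  assumes "u \<in> pos_cone b c d"
  shows "b * u \<in> pos_cone b c (Suc d)"
proof (cases "even d")
  case True
  then show ?thesis
    using assms by (auto simp: pos_cone_def even_iff_mod_2_eq_zero mod_Suc)
next
  case False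
  then obtain f where f: "nonneg_coeffs f" "u = b * eval_bivariate f (b\<^sup>2 - 2 * c) c"
    using assms by (auto simp: pos_cone_def odd_iff_mod_2_eq_one)
  \<comment> \<open>The factor \<open>b\<close> of \<open>u\<close> and the new one form a square,
    which the even part of the cone absorbs.\<close>
  then have "eval_bivariate f (b\<^sup>2 - 2 * c) c \<in> pos_cone b c (Suc d)"
    using False by (auto simp: pos_cone_def)
  from pos_cone_mult_square[OF this] show ?thesis
    by (simp add: f(2) power2_eq_square mult.assoc)
qed

subsection \<open>Trinomial coefficients and their minors\<close>

definition trinomial_coeff :: "'a::comm_ring_1 \<Rightarrow> 'a \<Rightarrow> nat \<Rightarrow> nat \<Rightarrow> 'a" where
  "trinomial_coeff b c n k = coeff ([:c, b, 1:] ^ n) (n + k)"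

lemma degree_trinomial_power: "degree ([:c, b, 1:] ^ n) \<le> 2 * n"
  for b c :: "'a::comm_ring_1"
  using degree_power_le[of "[:c, b, 1:]" n] by (simp split: if_splits)

lemma coeff_trinomial_power_Suc:
  "coeff ([:c, b, 1:] ^ Suc n) k =
    c * coeff ([:c, b, 1:] ^ n) k
    + (case k of 0 \<Rightarrow> 0 | Suc k' \<Rightarrow> b * coeff ([:c, b, 1:] ^ n) k'
        + (case k' of 0 \<Rightarrow> 0 | Suc k'' \<Rightarrow> coeff ([:c, b, 1:] ^ n) k''))"
  for b c :: "'a::comm_ring_1"
  by (simp add: coeff_pCons split: nat.split)

text \<open>This is the symmetry of \<open>x^2 + b x + c\<close> under \<open>x -> c / x\<close>. As
  \<open>c\<close> need not be invertible, it is proved by induction from the coefficient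
  recurrence.\<close>

lemma coeff_trinomial_power_reflect:
  fixes b c :: "'a::comm_ring_1"
  assumes "k + l = 2 * n" and "n \<le> l"
  shows "coeff ([:c, b, 1:] ^ n) k = c ^ (l - n) * coeff ([:c, b, 1:] ^ n) l"
  using assms
proof (induction n arbitrary: k l)
  case (Suc n)
  let ?a = "coeff ([:c, b, 1:] ^ n)"
  have vanish: "?a m = 0" if "2 * n < m" for m
    using degree_trinomial_power[of c b n] that by (intro coeff_eq_0) linarith
  show ?case
  proof (cases "l = Suc n")
    case True
    with Suc.prems show ?thesis by simp
  next
    case False
    define t where "t = l - n - 2"
    have l: "l = Suc (Suc (n + t))" and kt: "k + t = n"
      using False Suc.prems by (auto simp: t_def)
    \<comment> \<open>The three terms of the recurrence at \<open>k\<close> reflect to those at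
      \<open>l\<close>, in reverse order. If \<open>k < 2\<close>, a missing term on the left
      matches an index beyond the degree \<open>2 * n\<close> on the right.\<close>
    have A: "?a k = c ^ t * ?a (n + t)"
      using Suc.IH[of k "n + t"] kt by simp
    have B: "(case k of 0 \<Rightarrow> 0 | Suc k' \<Rightarrow> ?a k') = c ^ Suc t * ?a (Suc (n + t))"
      using Suc.IH[of "k - 1" "Suc (n + t)"] kt vanish[of "Suc (n + t)"] by (cases k) auto
    have C: "(case k of Suc (Suc k'') \<Rightarrow> ?a k'' | _ \<Rightarrow> 0) = c ^ Suc (Suc t) * ?a l"
      using Suc.IH[of "k - 2" l] kt vanish[of l] l
      by (auto split: nat.split)
    have "coeff ([:c, b, 1:] ^ Suc n) k = c * ?a k
        + b * (case k of 0 \<Rightarrow> 0 | Suc k' \<Rightarrow> ?a k')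
        + (case k of Suc (Suc k'') \<Rightarrow> ?a k'' | _ \<Rightarrow> 0)"
      unfolding coeff_trinomial_power_Suc by (simp split: nat.split)
    also have "\<dots> = c ^ (l - Suc n) * coeff ([:c, b, 1:] ^ Suc n) l"
      unfolding A B C coeff_trinomial_power_Suc by (simp add: l algebra_simps)
    finally show ?thesis .
  qed
qed simp

context
  fixes b c :: "'a::comm_ring_1"
begin

private abbreviation "a \<equiv> trinomial_coeff b c"

lemma trinomial_coeff_0_left: "a 0 k = (if k = 0 then 1 else 0)"
  by (simp add: trinomial_coeff_def coeff_1)

lemma trinomial_coeff_Suc_Suc: "a (Suc n) (Suc k) = a n k + b * a n (Suc k) + c * a n (Suc (Suc k))"
  unfolding trinomial_coeff_def coeff_trinomial_power_Suc by simp

text \<open>By reflection, the entry left of the centre is \<open>c\<close> times the one right of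
  it, hence the factor 2.\<close>

lemma trinomial_coeff_Suc_0: "a (Suc n) 0 = b * a n 0 + 2 * c * a n 1"
proof (cases n)
  case (Suc m)
  have "coeff ([:c, b, 1:] ^ n) m = c * coeff ([:c, b, 1:] ^ n) (Suc n)"
    using coeff_trinomial_power_reflect[of m "Suc n" n c b] Suc by simp
  then show ?thesis
    unfolding trinomial_coeff_def coeff_trinomial_power_Suc by (simp add: Suc algebra_simps)
qed (simp add: trinomial_coeff_def coeff_trinomial_power_Suc coeff_1)

lemma trinomial_coeff_in_pos_cone: "a n k \<in> pos_cone b c (n + k)"
proof (induction n arbitrary: k)
  case 0
  then show ?case using pos_cone_1[of b c] by (simp add: trinomial_coeff_0_left)
next
  case (Suc n)
  note IH = pos_cone_cong[OF Suc.IH]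
  show ?case
  proof (cases k)
    case 0
    have "b * a n 0 + (c * a n 1 + c * a n 1) \<in> pos_cone b c (Suc n)"
      by (intro pos_cone_add pos_cone_mult_base pos_cone_mult_indet2 IH) simp_all
    then show ?thesis by (simp add: 0 trinomial_coeff_Suc_0 algebra_simps)
  next
    case (Suc k')
    have "a n k' + b * a n (Suc k') + c * a n (Suc (Suc k')) \<in> pos_cone b c (Suc (Suc (n + k')))"
      by (intro pos_cone_add pos_cone_mult_base pos_cone_mult_indet2 IH) simp_all
    then show ?thesis by (simp add: Suc trinomial_coeff_Suc_Suc)
  qed
qed

definition trinomial_minor :: "nat \<Rightarrow> nat \<Rightarrow> nat \<Rightarrow> nat \<Rightarrow> 'a" where
  "trinomial_minor m n p q = a m p * a n q - a m q * a n p"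

lemma trinomial_minor_in_pos_cone:
  assumes "m \<le> n" and "p \<le> q"
  shows "trinomial_minor m n p q \<in> pos_cone b c (m + n + p + q)"
  using assms
proof (induction m arbitrary: n p q)
  case 0
  show ?case
    using trinomial_coeff_in_pos_cone[of n q] \<open>p \<le> q\<close>
    by (auto simp: trinomial_minor_def trinomial_coeff_0_left)
next
  case (Suc m n')
  then obtain n where n': "n' = Suc n" and "m \<le> n"
    by (cases n') auto
  let ?M = "trinomial_minor m n"
  note IH = pos_cone_cong[OF Suc.IH[OF \<open>m \<le> n\<close>]]
  note cone = pos_cone_add pos_cone_mult_base pos_cone_mult_indet1 pos_cone_mult_indet2
    pos_cone_mult_square IH
  note expand = n' trinomial_minor_def trinomial_coeff_Suc_0 trinomial_coeff_Suc_Suc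
    power2_eq_square algebra_simps
  \<comment> \<open>Column 0 of \<open>J\<close> is separate because of its entry
    \<open>2 c\<close>. Adjacent columns are separate because only their minors have a negative
    term.\<close>
  consider "p = q" | "p = 0" "q = 1" | t where "p = 0" "q = Suc (Suc t)"
    | r where "p = Suc r" "q = Suc (Suc r)"
    | r t where "p = Suc r" "q = Suc (Suc (Suc (r + t)))"
  proof -
    assume cases: "p = q \<Longrightarrow> thesis" "p = 0 \<Longrightarrow> q = 1 \<Longrightarrow> thesis"
      "\<And>t. p = 0 \<Longrightarrow> q = Suc (Suc t) \<Longrightarrow> thesis"
      "\<And>r. p = Suc r \<Longrightarrow> q = Suc (Suc r) \<Longrightarrow> thesis"
      "\<And>r t. p = Suc r \<Longrightarrow> q = Suc (Suc (Suc (r + t))) \<Longrightarrow> thesis"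
    obtain d where d: "q = p + d"
      using \<open>p \<le> q\<close> le_Suc_ex by blast
    show thesis
      by (cases p; cases d; cases "d - 1") (use d cases in auto)
  qed
  then show ?case
  proof cases
    case 1
    then show ?thesis by (simp add: trinomial_minor_def)
  next
    case 2
    have "(b\<^sup>2 - 2 * c) * ?M 0 1 + b * (c * ?M 0 2) + (c * (c * ?M 1 2) + c * (c * ?M 1 2))
      \<in> pos_cone b c (Suc (m + n))"
      by (intro cone) presburger+
    also have "(b\<^sup>2 - 2 * c) * ?M 0 1 + b * (c * ?M 0 2) + (c * (c * ?M 1 2) + c * (c * ?M 1 2))
      = trinomial_minor (Suc m) n' p q"
      unfolding 2 One_nat_def numeral_2_eq_2 by (simp add: expand)
    finally show ?thesis
      by (rule pos_cone_cong) (simp add: 2 n')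
  next
    case (3 t)
    let ?q = "Suc (Suc t)"
    \<comment> \<open>For \<open>t = 0\<close> the minors \<open>?M 1 (Suc t)\<close> have equal
      columns and vanish; the weak inequality \<open>p \<le> q\<close> in the induction covers
      them.\<close>
    have "b * ?M 0 (Suc t) + b\<^sup>2 * ?M 0 ?q + b * (c * ?M 0 (Suc ?q))
        + (c * ?M 1 (Suc t) + c * ?M 1 (Suc t)) + b * (c * ?M 1 ?q + c * ?M 1 ?q)
        + (c * (c * ?M 1 (Suc ?q)) + c * (c * ?M 1 (Suc ?q)))
      \<in> pos_cone b c (Suc (Suc (m + n + t)))" (is "?e \<in> _")
      by (intro cone) presburger+
    also have "?e = trinomial_minor (Suc m) n' p q"
      unfolding 3 One_nat_def by (simp add: expand)
    finally show ?thesis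
      by (rule pos_cone_cong) (simp add: 3 n')
  next
    case (4 r)
    let ?p = "Suc r"
    let ?q = "Suc ?p"
    have "?M r ?p + b * ?M r ?q + c * ?M r (Suc ?q)
        + ((b\<^sup>2 - 2 * c) * ?M ?p ?q + c * ?M ?p ?q) + b * (c * ?M ?p (Suc ?q))
        + c * (c * ?M ?q (Suc ?q))
      \<in> pos_cone b c (Suc (m + n))" (is "?e \<in> _")
      by (intro cone) presburger+
    also have "?e = trinomial_minor (Suc m) n' p q"
      unfolding 4 by (simp add: expand)
    finally show ?thesis
      by (rule pos_cone_cong) (simp add: 4 n'; presburger)
  next
    case (5 r t)
    let ?p = "Suc r"
    let ?s = "Suc (Suc (r + t))"
    let ?q = "Suc ?s"
    have "?M r ?s + b * ?M r ?q + c * ?M r (Suc ?q)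
        + b * ?M ?p ?s + b\<^sup>2 * ?M ?p ?q + b * (c * ?M ?p (Suc ?q))
        + c * ?M (Suc ?p) ?s + b * (c * ?M (Suc ?p) ?q) + c * (c * ?M (Suc ?p) (Suc ?q))
      \<in> pos_cone b c (Suc (Suc (m + n + r + ?s)))" (is "?e \<in> _")
      by (intro cone) presburger+
    also have "?e = trinomial_minor (Suc m) n' p q"
      unfolding 5 by (simp add: expand)
    finally show ?thesis
      by (rule pos_cone_cong) (simp add: 5 n'; presburger)
  qed
qed

lemma gen_trinomial_diff_in_pos_cone:
  assumes "1 \<le> i" and "i \<le> j"
  shows "gen_trinomial (i - 1) b c * gen_trinomial (j + 1) b c
    - gen_trinomial i b c * gen_trinomial j b c \<in> pos_cone b c (i + j)"
proof -
  obtain m where m: "i = Suc m"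
    using assms by (cases i) auto
  have T: "gen_trinomial n b c = a n 0" for n
    by (simp add: gen_trinomial_def trinomial_coeff_def)
  \<comment> \<open>Expanding \<open>T_i\<close> and \<open>T_(j+1)\<close> by the recursion for
    column 0, the terms with \<open>b\<close> cancel and twice \<open>c\<close> times this minor
    remains.\<close>
  have "trinomial_minor m j 0 1 \<in> pos_cone b c (i + j)"
    using trinomial_minor_in_pos_cone[of m j 0 1] assms m by simp
  then have "c * trinomial_minor m j 0 1 + c * trinomial_minor m j 0 1 \<in> pos_cone b c (i + j)"
    by (intro pos_cone_add pos_cone_mult_indet2)
  then show ?thesis
    by (simp add: T m trinomial_minor_def trinomial_coeff_Suc_0 algebra_simps)
qed

end

theorem theorem3p10:
  fixes i j :: nat and b c :: "int poly poly"
  defines "b \<equiv> indet1" and "c \<equiv> indet2"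
  assumes "1 \<le> i" and "i \<le> j"
  shows "\<exists>f :: int poly poly.
    (\<forall>k l. 0 \<le> coeff (coeff f l) k) \<and>
    gen_trinomial (i - 1) b c * gen_trinomial (j + 1) b c
      - gen_trinomial i b c * gen_trinomial j b c
    = b ^ nat ((1 - (-1) ^ (i + j)) div 2) * eval_bivariate f (b ^ 2 - 2 * c) c"
proof -
  \<comment> \<open>The integer quotient is 0 or 1, which is the exponent of \<open>b\<close> built
    into \<open>pos_cone\<close>.\<close>
  have "nat ((1 - (-1) ^ (i + j)) div 2) = (i + j) mod 2"
    by (cases "even (i + j)") (simp_all add: even_iff_mod_2_eq_zero odd_iff_mod_2_eq_one)
  then show ?thesis
    using gen_trinomial_diff_in_pos_cone[OF assms(3,4), of b c]
    by (auto simp: pos_cone_def nonneg_coeffs_def)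
qed

end
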